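(* Let $k\ge1$ be an integer and $d\in A_k$. If $d\to(P,Q)$ under the insertion map defined in the context, then $\mathrm{flip}(d)\to(Q,P)$.
   Context: $A_k$ is the set of set partitions of $\{1,\ldots,k,1',\ldots,k'\}$. For $d\in A_k$, $\mathrm{flip}(d)\in A_k$ is the set partition obtained from $d$ by exchanging $i$ and $i'$ for every $1\le i\le k$ (reflecting the two-row diagram of $d$ over its horizontal axis). Standard representation of $d\in A_k$: relabel the vertex $j'$ as $2k-j+1$, so that $d$ becomes a set partition of $\{1,\ldots,2k\}$, drawn with vertices in a row. Connect $i<j$ by an edge if and only if $i,j$ are in the same block and no $m$ with $i<m<j$ is in that block. Label each edge by $2k+1-\ell$, where $\ell$ is its right (larger) endpoint. Each vertex is the left endpoint of at most one edge and the right endpoint of at most one edge. Insertion sequence of $d$: $E=(E_{1/2},E_1,E_{3/2},\ldots,E_{2k-1/2},E_{2k})$, where for each integer $1\le j\le 2k$: $E_j=a$ if vertex $j$ is the left endpoint of the edge labeled $a$, and $E_j=\emptyset$ if $j$ is not a left endpoint; $E_{j-1/2}=a$ if vertex $j$ is the right endpoint of the edge labeled $a$, and $E_{j-1/2}=\emptyset$ if $j$ is not a right endpoint. A "tableau" is a filling of a Young diagram (English convention) by distinct positive integers increasing along rows and down columns. Jeu de taquin deletion of an entry $x$: while the box of $x$ is not a corner (end of both its row and column), exchange $x$ with the smaller of the entries immediately below and immediately to the right (or the only one that exists); then delete the corner containing $x$. RSK row insertion of $x$: let $R$ be the first row; while $x$ is less than some element of $R$, replace the smallest element $y>x$ of $R$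 by $x$, set $x:=y$, and let $R$ be the next row; finally place $x$ at the end of $R$. Insertion map: let $T^{(0)}=\emptyset$. For $0\le j\le 2k-1$, $T^{(j+1/2)}$ is $T^{(j)}$ with $E_{j+1/2}$ deleted by jeu de taquin if $E_{j+1/2}\ne\emptyset$, and $T^{(j+1/2)}=T^{(j)}$ otherwise; $T^{(j+1)}$ is $T^{(j+1/2)}$ with $E_{j+1}$ row-inserted if $E_{j+1}\neq\emptyset$, and $T^{(j+1)}=T^{(j+1/2)}$ otherwise. Let $\lambda^{(i)}$ be the shape of $T^{(i)}$ for all $i\in\{0,\frac12,1,\ldots,2k\}$. Put $Q=(\lambda^{(0)},\lambda^{(1/2)},\ldots,\lambda^{(k-1/2)},\lambda^{(k)})$ and $P=(\lambda^{(2k)},\lambda^{(2k-1/2)},\ldots,\lambda^{(k+1/2)},\lambda^{(k)})$. One writes $d\to(P,Q)$. *)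

theory Defs
  imports Main "HOL-Library.Disjoint_Sets"
begin

datatype vertex = Unprimed nat | Primed nat

definition vertices :: "nat \<Rightarrow> vertex set" where
  "vertices k = Unprimed ` {1..k} \<union> Primed ` {1..k}"

definition set_partitions :: "nat \<Rightarrow> vertex set set set" where
  "set_partitions k = {d. partition_on (vertices k) d}"

fun flip_vertex :: "vertex \<Rightarrow> vertex" where
  "flip_vertex (Unprimed i) = Primed i"
| "flip_vertex (Primed i) = Unprimed i"

definition flip :: "vertex set set \<Rightarrow> vertex set set" where
  "flip d = (\<lambda>B. flip_vertex ` B) ` d"

lemma flip_in_set_partitions:
  assumes "d \<in> set_partitions k"
  shows "flip d \<in> set_partitions k"
proof -
  have inj: "inj_on flip_vertex (\<Union>d)"
  proof (rule inj_onI)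
    fix x y assume "flip_vertex x = flip_vertex y"
    then show "x = y" by (cases x; cases y) auto
  qed
  have "flip_vertex ` vertices k = vertices k"
    by (auto simp: vertices_def image_Un image_image)
  moreover have "\<Union>d = vertices k" "{} \<notin> d" "disjoint d"
    using assms by (auto simp: set_partitions_def partition_on_def)
  ultimately show ?thesis
    using inj unfolding set_partitions_def partition_on_def flip_def
    by (auto simp: disjoint_image simp flip: image_Union)
qed

fun relabel :: "nat \<Rightarrow> vertex \<Rightarrow> nat" where
  "relabel k (Unprimed i) = i"
| "relabel k (Primed j) = 2 * k + 1 - j"

definition standardize :: "nat \<Rightarrow> vertex set set \<Rightarrow> nat set set" where
  "standardize k d = (\<lambda>B. relabel k ` B) ` d"

definition edge :: "nat \<Rightarrow> vertex set set \<Rightarrow> nat \<Rightarrow> nat \<Rightarrow> bool" where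
  "edge k d i j \<longleftrightarrow>
     i < j \<and> (\<exists>B\<in>standardize k d. i \<in> B \<and> j \<in> B \<and> \<not> (\<exists>m\<in>B. i < m \<and> m < j))"

text \<open>The label of an edge whose right endpoint is the given vertex.\<close>

definition edge_label :: "nat \<Rightarrow> nat \<Rightarrow> nat" where
  "edge_label k l = 2 * k + 1 - l"

text \<open>
  Half-integer indices are doubled throughout: entry \<open>n\<close> below is $E_{n/2}$, so even
  \<open>n = 2j\<close> gives $E_j$ and odd \<open>n = 2j - 1\<close> gives $E_{j-1/2}$. The empty entry is \<open>None\<close>.
  Only \<open>1 \<le> n \<le> 4k\<close> is meaningful.
\<close>

definition insertion_sequence :: "nat \<Rightarrow> vertex set set \<Rightarrow> nat \<Rightarrow> nat option" where
  "insertion_sequence k d n =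
     (if even n then
        let j = n div 2 in
        if \<exists>l. edge k d j l then Some (edge_label k (THE l. edge k d j l)) else None
      else
        let j = (n + 1) div 2 in
        if \<exists>i. edge k d i j then Some (edge_label k j) else None)"

text \<open>
  A tableau is the list of its nonempty rows, from top to bottom; rows and columns are
  indexed from 0.
\<close>

type_synonym tableau = "nat list list"

definition shape :: "tableau \<Rightarrow> nat list" where
  "shape T = map length T"

definition is_box :: "tableau \<Rightarrow> nat \<Rightarrow> nat \<Rightarrow> bool" where
  "is_box T r c \<longleftrightarrow> r < length T \<and> c < length (T ! r)"

definition set_entry :: "tableau \<Rightarrow> nat \<Rightarrow> nat \<Rightarrow> nat \<Rightarrow> tableau" where
  "set_entry T r c x = T[r := (T ! r)[c := x]]"

definition exchange :: "tableau \<Rightarrow> nat \<Rightarrow> nat \<Rightarrow> nat \<Rightarrow> nat \<Rightarrow> tableau" where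
  "exchange T r c r' c' = set_entry (set_entry T r c (T ! r' ! c')) r' c' (T ! r ! c)"

definition delete_corner :: "tableau \<Rightarrow> nat \<Rightarrow> tableau" where
  "delete_corner T r = filter (\<lambda>R. R \<noteq> []) (T[r := butlast (T ! r)])"

text \<open>Jeu de taquin moving the entry in box \<open>(r, c)\<close>.\<close>

function jdt :: "tableau \<Rightarrow> nat \<Rightarrow> nat \<Rightarrow> tableau" where
  "jdt T r c =
     (if is_box T r (c + 1) \<and> (is_box T (r + 1) c \<longrightarrow> T ! r ! (c + 1) < T ! (r + 1) ! c)
        then jdt (exchange T r c r (c + 1)) r (c + 1)
      else if is_box T (r + 1) c
        then jdt (exchange T r c (r + 1) c) (r + 1) c
      else delete_corner T r)"
  by pat_completeness auto
termination
  by (relation "measures [\<lambda>(T, r, c). length T - r, \<lambda>(T, r, c). length (T ! r) - c]")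
    (auto simp: is_box_def exchange_def set_entry_def)

declare jdt.simps [simp del]

text \<open>Only used when \<open>x\<close> is an entry of \<open>T\<close>, so that the described box exists and is unique.\<close>

definition jdt_delete :: "nat \<Rightarrow> tableau \<Rightarrow> tableau" where
  "jdt_delete x T =
     (let (r, c) = (THE (r, c). is_box T r c \<and> T ! r ! c = x) in jdt T r c)"

fun row_insert :: "nat \<Rightarrow> tableau \<Rightarrow> tableau" where
  "row_insert x [] = [[x]]"
| "row_insert x (R # Rs) =
     (if \<exists>y\<in>set R. x < y
      then let y = Min {y \<in> set R. x < y}
           in map (\<lambda>z. if z = y then x else z) R # row_insert y Rs
      else (R @ [x]) # Rs)"

text \<open>With doubled indices, \<open>insertion_tableau k d n\<close> is $T^{(n/2)}$.\<close>

primrec insertion_tableau :: "nat \<Rightarrow> vertex set set \<Rightarrow> nat \<Rightarrow> tableau" where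
  "insertion_tableau k d 0 = []"
| "insertion_tableau k d (Suc n) =
     (case insertion_sequence k d (Suc n) of
        None \<Rightarrow> insertion_tableau k d n
      | Some a \<Rightarrow>
          if odd (Suc n) then jdt_delete a (insertion_tableau k d n)
          else row_insert a (insertion_tableau k d n))"

definition insertion_shape :: "nat \<Rightarrow> vertex set set \<Rightarrow> nat \<Rightarrow> nat list" where
  "insertion_shape k d n = shape (insertion_tableau k d n)"

definition P_sequence :: "nat \<Rightarrow> vertex set set \<Rightarrow> nat list list" where
  "P_sequence k d = map (insertion_shape k d) (rev [2 * k..<4 * k + 1])"

definition Q_sequence :: "nat \<Rightarrow> vertex set set \<Rightarrow> nat list list" where
  "Q_sequence k d = map (insertion_shape k d) [0..<2 * k + 1]"

definition inserts_to ::
  "nat \<Rightarrow> vertex set set \<Rightarrow> nat list list \<times> nat list list \<Rightarrow> bool" where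
  "inserts_to k d PQ \<longleftrightarrow> PQ = (P_sequence k d, Q_sequence k d)"

end

theory Submission
  imports Defs
begin

text \<open>
  An edge is deleted when the sweep reaches its right endpoint, and its label is then the largest
  entry present, so the deletion just removes a corner. Since row insertion commutes with
  restriction to small entries, \<open>T\<^sup>(\<^sup>j\<^sup>)\<close> is the insertion tableau of the partial
  permutation formed by the edges crossing position \<open>j\<close>. Flipping \<open>d\<close> inverts this partial
  permutation and reverses the sweep. The shape of the insertion tableau is invariant under
  inversion because shapes obey Fomin's local rules, which are symmetric.
\<close>

section \<open>Adding a box to a shape\<close>

text \<open>The index \<open>r = length l\<close> opens a new row, and so would any larger one;
  hence the bounds \<open>r \<le> length l\<close> in what follows.\<close>

definition add_box :: "nat list \<Rightarrow> nat \<Rightarrow> nat list" where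
  "add_box l r = (if r < length l then l[r := Suc (l ! r)] else l @ [1])"

definition row_length :: "nat list \<Rightarrow> nat \<Rightarrow> nat" where
  "row_length l r = (if r < length l then l ! r else 0)"

text \<open>Forbidding 0 matches tableaux stored without empty rows. As \<open>row_length\<close> is
  0 past the end, the last row needs no separate case.\<close>

definition is_partition :: "nat list \<Rightarrow> bool" where
  "is_partition l \<longleftrightarrow> 0 \<notin> set l \<and> (\<forall>r. row_length l (Suc r) \<le> row_length l r)"

lemma row_length_add_box:
  "r \<le> length l \<Longrightarrow> row_length (add_box l r) q = row_length l q + (if q = r then 1 else 0)"
  by (auto simp: row_length_def add_box_def nth_append)

lemma length_add_box: "length (add_box l r) = (if r < length l then length l else Suc (length l))"
  by (simp add: add_box_def)

lemma zero_notin_add_box: "0 \<notin> set l \<Longrightarrow> 0 \<notin> set (add_box l r)"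
  using set_update_subset_insert[of l r "Suc (l ! r)"] by (auto simp: add_box_def)

lemma add_box_inject:
  assumes "add_box l r = add_box l s" "r \<le> length l" "s \<le> length l"
  shows "r = s"
  using row_length_add_box[OF assms(2), of r] row_length_add_box[OF assms(3), of r] assms(1)
  by (auto split: if_splits)

lemma add_box_commute:
  assumes "r \<noteq> s" "r \<le> length l" "s \<le> length l"
  shows "add_box (add_box l r) s = add_box (add_box l s) r"
  using assms by (auto simp: add_box_def list_update_swap list_update_append nth_append)

text \<open>This is Fomin's local rule: if both boxes want the same row, the second goes one row
  lower. Each inequality between neighbouring rows is inherited from one of the three given
  partitions.\<close>

lemma is_partition_add_two_boxes:
  assumes "is_partition l" "is_partition (add_box l r)" "is_partition (add_box l s)"
    "r \<le> length l" "s \<le> length l"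
  shows "is_partition (add_box (add_box l r) (if s = r then Suc s else s))"
proof -
  let ?t = "if s = r then Suc s else s"
  have t: "?t \<le> length (add_box l r)"
    using assms(4,5) by (auto simp: length_add_box)
  have "row_length (add_box (add_box l r) ?t) (Suc q) \<le> row_length (add_box (add_box l r) ?t) q" for q
  proof -
    have "row_length l (Suc q) \<le> row_length l q"
      "row_length (add_box l r) (Suc q) \<le> row_length (add_box l r) q"
      "row_length (add_box l s) (Suc q) \<le> row_length (add_box l s) q"
      using assms(1-3) by (auto simp: is_partition_def)
    then show ?thesis
      using assms(4,5) t by (auto simp: row_length_add_box split: if_splits)
  qed
  then show ?thesis
    using assms(1) by (auto simp: is_partition_def zero_notin_add_box)
qed

section \<open>Row insertion in the presence of a largest entry\<close>

definition add_entry :: "nat \<Rightarrow> nat \<Rightarrow> tableau \<Rightarrow> tableau" where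
  "add_entry s m T = (if s < length T then T[s := T ! s @ [m]] else T @ [[m]])"

definition entries :: "tableau \<Rightarrow> nat set" where
  "entries T = \<Union> (set ` set T)"

fun insert_row :: "nat \<Rightarrow> tableau \<Rightarrow> nat" where
  "insert_row x [] = 0"
| "insert_row x (R # Rs) =
     (if \<exists>y\<in>set R. x < y then Suc (insert_row (Min {y \<in> set R. x < y}) Rs) else 0)"

lemma shape_add_entry: "shape (add_entry s m T) = add_box (shape T) s"
  by (simp add: shape_def add_entry_def add_box_def map_update)

lemma length_shape: "length (shape T) = length T"
  by (simp add: shape_def)

lemma insert_row_le: "insert_row x T \<le> length T"
  by (induction x T rule: insert_row.induct) auto

lemma shape_row_insert: "shape (row_insert x T) = add_box (shape T) (insert_row x T)"
  by (induction x T rule: insert_row.induct) (auto simp: shape_def add_box_def Let_def)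

lemma Min_greater_mem:
  fixes x :: nat
  assumes "\<exists>y\<in>set R. x < y"
  shows "Min {y \<in> set R. x < y} \<in> set R" "x < Min {y \<in> set R. x < y}"
proof -
  have "Min {y \<in> set R. x < y} \<in> {y \<in> set R. x < y}"
    using assms by (intro Min_in) auto
  then show "Min {y \<in> set R. x < y} \<in> set R" "x < Min {y \<in> set R. x < y}"
    by blast+
qed

lemma entries_row_insert: "entries (row_insert x T) \<subseteq> insert x (entries T)"
proof (induction x T rule: row_insert.induct)
  case (2 x R Rs)
  then show ?case
    using Min_greater_mem(1)[of R x] by (auto simp: entries_def Let_def)
qed (simp add: entries_def)

lemma row_insert_largest: "entries T \<subseteq> {..<m} \<Longrightarrow> row_insert m T = add_entry 0 m T"
  by (cases T) (fastforce simp: entries_def add_entry_def)+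

text \<open>The largest entry \<open>m\<close> ends its row, so the bumping path of \<open>x\<close>
  meets it only where \<open>x\<close> would otherwise have ended by appending. Then
  \<open>m\<close> is bumped and, being largest, appended to the next row; on any other path it
  stays put.\<close>

lemma row_insert_add_entry:
  assumes "entries T \<subseteq> {..<m}" "x < m" "s \<le> length T"
  shows "row_insert x (add_entry s m T) =
    add_entry (if s = insert_row x T then Suc s else s) m (row_insert x T)"
  using assms
proof (induction x T arbitrary: s rule: row_insert.induct)
  case (1 x)
  then have "{y. y = m \<and> x < y} = {m}" by auto
  then show ?case
    using 1 by (simp add: add_entry_def Let_def)
next
  case (2 x R Rs)
  have R: "z < m" if "z \<in> set R" for z
    using 2(2) that by (auto simp: entries_def)
  have Rs: "entries Rs \<subseteq> {..<m}"
    using 2(2) by (auto simp: entries_def)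
  show ?case
  proof (cases "\<exists>y\<in>set R. x < y")
    case True
    let ?y = "Min {y \<in> set R. x < y}"
    note y = Min_greater_mem[OF True]
    \<comment> \<open>Some old entry already exceeds \<open>x\<close>, so the presence of
      \<open>m\<close> does not change which entry is bumped.\<close>
    have min: "Min {y. (y = m \<or> y \<in> set R) \<and> x < y} = ?y"
    proof -
      have "{y. (y = m \<or> y \<in> set R) \<and> x < y} = insert m {y \<in> set R. x < y}"
        using 2(3) by auto
      then show ?thesis
        using True R[OF y(1)] by (subst \<open>_ = insert _ _\<close>, subst Min_insert) (auto simp: min_def)
    qed
    show ?thesis
    proof (cases s)
      case 0
      then show ?thesis
        using True min R[OF y(1)] by (auto simp: add_entry_def Let_def)
    next
      case (Suc q)
      have "row_insert ?y (add_entry q m Rs) =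
          add_entry (if q = insert_row ?y Rs then Suc q else q) m (row_insert ?y Rs)"
        using 2(1)[OF True refl Rs R[OF y(1)]] 2(4) Suc by simp
      moreover have "add_entry (Suc p) m (Q # Qs) = Q # add_entry p m Qs" for p Q Qs
        by (simp add: add_entry_def)
      ultimately show ?thesis
        using True Suc by (simp add: Let_def)
    qed
  next
    case False
    \<comment> \<open>No old entry of this row exceeds \<open>x\<close>: if \<open>m\<close> is
      here, it is the one bumped.\<close>
    have bump: "{y. (y = m \<or> y \<in> set R) \<and> x < y} = {m}"
      using False 2(3) by auto
    have R': "map (\<lambda>z. if z = m then x else z) R = R"
      using R by (intro map_idI) force
    show ?thesis
    proof (cases s)
      case 0
      then show ?thesis
        using False 2(3) bump R' row_insert_largest[OF Rs]
        by (simp add: add_entry_def Let_def)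
    next
      case (Suc q)
      then show ?thesis
        using False by (simp add: add_entry_def)
    qed
  qed
qed

section \<open>Insertion tableaux of partial permutations\<close>

definition partial_inj :: "(nat \<Rightarrow> nat option) \<Rightarrow> bool" where
  "partial_inj f \<longleftrightarrow> (\<forall>x x' y. f x = Some y \<longrightarrow> f x' = Some y \<longrightarrow> x = x')"

text \<open>The values of \<open>f\<close> below \<open>b\<close> at positions below
  \<open>a\<close> are inserted in order of position. The shapes, as \<open>a\<close> and
  \<open>b\<close> vary, form the growth diagram of \<open>f\<close>.\<close>

primrec perm_tableau :: "(nat \<Rightarrow> nat option) \<Rightarrow> nat \<Rightarrow> nat \<Rightarrow> tableau" where
  "perm_tableau f b 0 = []"
| "perm_tableau f b (Suc a) =
     (case f a of
        None \<Rightarrow> perm_tableau f b a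
      | Some y \<Rightarrow> if y < b then row_insert y (perm_tableau f b a) else perm_tableau f b a)"

lemma entries_perm_tableau: "entries (perm_tableau f b a) \<subseteq> {..<b}"
proof (induction a)
  case (Suc a)
  have "entries (row_insert y (perm_tableau f b a)) \<subseteq> {..<b}" if "y < b" for y
    using entries_row_insert[of y "perm_tableau f b a"] Suc that by auto
  then show ?case
    using Suc by (simp split: option.split)
qed (simp add: entries_def)

lemma perm_tableau_bound_absent:
  "\<forall>x<a. f x \<noteq> Some m \<Longrightarrow> perm_tableau f (Suc m) a = perm_tableau f m a"
  by (induction a) (auto simp: less_Suc_eq split: option.split)

lemma perm_tableau_bound_0: "perm_tableau f 0 a = []"
  by (induction a) (auto split: option.split)

text \<open>The value \<open>m\<close> enters at the end of the first row; every later insertion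
  either leaves it alone or pushes it one row down.\<close>

lemma perm_tableau_bound_present:
  assumes "partial_inj f" "x < a" "f x = Some m"
  shows "\<exists>s\<le>length (perm_tableau f m a). perm_tableau f (Suc m) a = add_entry s m (perm_tableau f m a)"
  using assms(2)
proof (induction a)
  case (Suc a)
  show ?case
  proof (cases "x = a")
    case True
    have "\<forall>x'<a. f x' \<noteq> Some m"
      using assms(1,3) True unfolding partial_inj_def by blast
    then show ?thesis
      using True assms(3) row_insert_largest[OF entries_perm_tableau]
      by (intro exI[of _ 0]) (simp add: perm_tableau_bound_absent)
  next
    case False
    then obtain s where s: "s \<le> length (perm_tableau f m a)"
      "perm_tableau f (Suc m) a = add_entry s m (perm_tableau f m a)"
      using Suc by auto
    have "f a \<noteq> Some m"
      using False assms(1,3) unfolding partial_inj_def by blast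
    then consider "\<And>y. f a = Some y \<Longrightarrow> m < y" | y where "f a = Some y" "y < m"
      by (metis linorder_neqE_nat)
    then show ?thesis
    proof cases
      case 1
      then show ?thesis
        using s by (cases "f a") (auto dest: less_imp_not_less)
    next
      case 2
      let ?T = "perm_tableau f m a"
      \<comment> \<open>If \<open>m\<close> is pushed down from row \<open>s\<close>, the new box
        lies in row \<open>s\<close>, so that row exists and \<open>Suc s\<close> is still within
        bounds.\<close>
      have "length (row_insert y ?T) = length (add_box (shape ?T) (insert_row y ?T))"
        by (metis length_shape shape_row_insert)
      then have "(if s = insert_row y ?T then Suc s else s) \<le> length (row_insert y ?T)"
        using s(1) by (auto simp: length_add_box length_shape)
      then show ?thesis
        using 2 s row_insert_add_entry[OF entries_perm_tableau 2(2) s(1)] by auto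
    qed
  qed
qed simp

section \<open>Local rules on the cells of the growth diagram\<close>

lemma perm_shape_corner:
  assumes "partial_inj f" "f a = Some b"
  shows "shape (perm_tableau f (Suc b) (Suc a)) = add_box (shape (perm_tableau f b a)) 0"
proof -
  have "\<forall>x<a. f x \<noteq> Some b"
    using assms unfolding partial_inj_def by blast
  then show ?thesis
    using assms(2) row_insert_largest[OF entries_perm_tableau]
    by (simp add: perm_tableau_bound_absent shape_add_entry)
qed

text \<open>Here column \<open>a\<close> is marked below the cell and row \<open>b\<close> to its
  left. Reading the new position adds a box in row \<open>r\<close>, allowing the new value adds one
  in row \<open>s\<close>, and doing both is governed by
  \<open>row_insert_add_entry\<close>.\<close>

lemma perm_shape_local_rule:
  assumes "partial_inj f" "f a = Some y" "y < b" "x < a" "f x = Some b"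
  obtains r s where
    "r \<le> length (shape (perm_tableau f b a))" "s \<le> length (shape (perm_tableau f b a))"
    "shape (perm_tableau f b (Suc a)) = add_box (shape (perm_tableau f b a)) r"
    "shape (perm_tableau f (Suc b) a) = add_box (shape (perm_tableau f b a)) s"
    "shape (perm_tableau f (Suc b) (Suc a)) =
      add_box (add_box (shape (perm_tableau f b a)) r) (if s = r then Suc s else s)"
proof -
  let ?T = "perm_tableau f b a"
  obtain s where s: "s \<le> length ?T" "perm_tableau f (Suc b) a = add_entry s b ?T"
    using perm_tableau_bound_present[OF assms(1,4,5)] by blast
  show thesis
    using assms(2,3) s row_insert_add_entry[OF entries_perm_tableau assms(3) s(1)]
    by (intro that[of "insert_row y ?T" s])
      (simp_all add: length_shape insert_row_le shape_row_insert shape_add_entry)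
qed

text \<open>The cell at column \<open>a\<close> and row \<open>b\<close> is marked; or both its
  column below and its row to the left are marked; or one of the two lines carries no mark up to and
  including the cell, so that crossing it changes nothing.\<close>

lemma perm_tableau_cases [case_names corner both skip_column skip_row]:
  fixes f :: "nat \<Rightarrow> nat option" and a b :: nat
  obtains "f a = Some b"
  | x y where "f a = Some y" "y < b" "x < a" "f x = Some b"
  | "\<And>y. f a = Some y \<Longrightarrow> b < y"
  | "\<And>x. x \<le> a \<Longrightarrow> f x \<noteq> Some b"
  by (metis le_eq_less_or_eq linorder_neqE_nat option.inject)

lemma perm_tableau_skip_column:
  "(\<And>y. f a = Some y \<Longrightarrow> b \<le> y) \<Longrightarrow> perm_tableau f b (Suc a) = perm_tableau f b a"
  by (auto split: option.split simp: not_less)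

lemma perm_tableau_skip_row:
  "(\<And>x. x \<le> a \<Longrightarrow> f x \<noteq> Some b) \<Longrightarrow>
    perm_tableau f (Suc b) (Suc a) = perm_tableau f b (Suc a)"
  by (rule perm_tableau_bound_absent) auto

text \<open>The local rules preserve partitions, so induction over the growth diagram gives this
  without tracking that the tableaux increase along rows and columns.\<close>

lemma is_partition_perm_shape:
  assumes "partial_inj f"
  shows "is_partition (shape (perm_tableau f b a))"
proof (induction "a + b" arbitrary: a b rule: less_induct)
  case less
  show ?case
  proof (cases "a = 0 \<or> b = 0")
    case True
    then show ?thesis
      by (auto simp: perm_tableau_bound_0 shape_def is_partition_def row_length_def)
  next
    case False
    then obtain a' b' where ab: "a = Suc a'" "b = Suc b'"
      by (metis not0_implies_Suc)
    have IH: "is_partition (shape (perm_tableau f b' a'))"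
      "is_partition (shape (perm_tableau f (Suc b') a'))"
      "is_partition (shape (perm_tableau f b' (Suc a')))"
      using less[of a' b'] less[of a' "Suc b'"] less[of "Suc a'" b'] ab by simp_all
    show ?thesis
    proof (cases f a' b' rule: perm_tableau_cases)
      case corner
      have "row_length (add_box l 0) (Suc r) \<le> row_length (add_box l 0) r"
        if "is_partition l" for l r
        using that by (auto simp: row_length_add_box is_partition_def intro: le_SucI)
      then show ?thesis
        using IH(1) unfolding ab perm_shape_corner[OF assms corner]
        by (auto simp: is_partition_def zero_notin_add_box)
    next
      case (both x y)
      show ?thesis
        using perm_shape_local_rule[OF assms both] IH is_partition_add_two_boxes
        unfolding ab by metis
    next
      case skip_column
      then show ?thesis
        using IH(2) perm_tableau_skip_column[of f a' b] unfolding ab by force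
    next
      case skip_row
      then show ?thesis
        using IH(3) perm_tableau_skip_row[of a' f b'] unfolding ab by simp
    qed
  qed
qed

text \<open>Inverting \<open>f\<close> transposes the growth diagram. The local rules survive this:
  boxes in different rows commute, and boxes in equal rows give the same outcome.\<close>

theorem perm_shape_inverse:
  assumes fg: "\<And>x y. f x = Some y \<longleftrightarrow> g y = Some x"
  shows "shape (perm_tableau f b a) = shape (perm_tableau g a b)"
proof (induction "a + b" arbitrary: a b rule: less_induct)
  case less
  have inj: "partial_inj f" "partial_inj g"
    unfolding partial_inj_def using fg by (metis option.inject)+
  show ?case
  proof (cases "a = 0 \<or> b = 0")
    case True
    then show ?thesis
      by (auto simp: perm_tableau_bound_0)
  next
    case False
    then obtain a' b' where ab: "a = Suc a'" "b = Suc b'"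
      by (metis not0_implies_Suc)
    have IH: "shape (perm_tableau f b' a') = shape (perm_tableau g a' b')"
      "shape (perm_tableau f (Suc b') a') = shape (perm_tableau g a' (Suc b'))"
      "shape (perm_tableau f b' (Suc a')) = shape (perm_tableau g (Suc a') b')"
      using less[of a' b'] less[of a' "Suc b'"] less[of "Suc a'" b'] ab by simp_all
    show ?thesis
    proof (cases f a' b' rule: perm_tableau_cases)
      case corner
      then show ?thesis
        using perm_shape_corner[OF inj(1)] perm_shape_corner[OF inj(2)] fg IH(1)
        unfolding ab by metis
    next
      case (both x y)
      let ?l = "shape (perm_tableau f b' a')"
      obtain r s where rs: "r \<le> length ?l" "s \<le> length ?l"
        "shape (perm_tableau f b' (Suc a')) = add_box ?l r"
        "shape (perm_tableau f (Suc b') a') = add_box ?l s"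
        "shape (perm_tableau f (Suc b') (Suc a')) =
          add_box (add_box ?l r) (if s = r then Suc s else s)"
        using perm_shape_local_rule[OF inj(1) both] by blast
      have "g b' = Some x" "g y = Some a'"
        using both fg by auto
      then obtain r' s' where rs': "r' \<le> length ?l" "s' \<le> length ?l"
        "shape (perm_tableau g a' (Suc b')) = add_box ?l r'"
        "shape (perm_tableau g (Suc a') b') = add_box ?l s'"
        "shape (perm_tableau g (Suc a') (Suc b')) =
          add_box (add_box ?l r') (if s' = r' then Suc s' else s')"
        using perm_shape_local_rule[OF inj(2) _ both(3) both(2)] unfolding IH(1) by metis
      \<comment> \<open>The row of an added box can be read off the resulting shape, so the
        induction hypotheses identify the rows.\<close>
      have "r' = s" "s' = r"
        using rs rs' IH add_box_inject by metis+
      then show ?thesis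
        using rs rs'(5) unfolding ab by (auto simp: add_box_commute)
    next
      case skip_column
      \<comment> \<open>A column of \<open>f\<close> is a row of \<open>g\<close>, so the two skip
        cases trade places.\<close>
      then have "\<And>y. y \<le> b' \<Longrightarrow> g y \<noteq> Some a'"
        using fg by (meson not_less)
      then show ?thesis
        using skip_column IH(2) perm_tableau_skip_column[of f a' b]
          perm_tableau_skip_row[of b' g a']
        unfolding ab by (metis Suc_leI)
    next
      case skip_row
      then have "\<And>x. g b' = Some x \<Longrightarrow> Suc a' \<le> x"
        using fg by (meson not_less_eq_eq)
      then show ?thesis
        using skip_row IH(3) perm_tableau_skip_row[of a' f b']
          perm_tableau_skip_column[of g b' "Suc a'"]
        unfolding ab by metis
    qed
  qed
qed

section \<open>Deleting the largest entry\<close>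

text \<open>The box of \<open>m\<close> is already a corner, so jeu de taquin makes no
  exchange.\<close>

lemma jdt_delete_add_entry:
  assumes T: "entries T \<subseteq> {..<m}" "is_partition (shape T)" and s: "s \<le> length T"
  shows "jdt_delete m (add_entry s m T) = T"
proof -
  let ?U = "add_entry s m T"
  define c where "c = row_length (shape T) s"
  have small: "T ! p ! q < m" if "p < length T" "q < length (T ! p)" for p q
  proof -
    have "T ! p ! q \<in> entries T"
      using nth_mem[OF that(1)] nth_mem[OF that(2)] unfolding entries_def by blast
    then show ?thesis
      using T(1) by auto
  qed
  have len: "r < length ?U \<longleftrightarrow> r < length T \<or> r = s" for r
    using s by (auto simp: add_entry_def)
  have row: "?U ! r = (if r = s then (if s < length T then T ! s @ [m] else [m]) else T ! r)"
    if "r < length ?U" for r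
    using that s by (auto simp: add_entry_def nth_append)
  have c: "c = (if s < length T then length (T ! s) else 0)"
    by (simp add: c_def row_length_def shape_def)
  have "is_box ?U p q \<and> ?U ! p ! q = m \<longleftrightarrow> p = s \<and> q = c" for p q
    using small[of p q] by (auto simp: is_box_def len row c nth_append split: if_splits)
  then have pos: "(THE (p, q). is_box ?U p q \<and> ?U ! p ! q = m) = (s, c)"
    by (simp, intro the_equality) auto
  have "\<not> is_box ?U s (c + 1)"
    using row[of s] by (auto simp: is_box_def c split: if_splits)
  \<comment> \<open>\<open>c\<close> is the length of row \<open>s\<close> before \<open>m\<close>
    was added; the row below is no longer than that and has no box in column
    \<open>c\<close>.\<close>
  moreover have "row_length (shape T) (Suc s) \<le> c"
    using T(2) by (simp add: is_partition_def c_def)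
  then have "\<not> is_box ?U (s + 1) c"
    using row[of "Suc s"] by (auto simp: is_box_def len row_length_def shape_def)
  ultimately have "jdt ?U s c = delete_corner ?U s"
    by (subst jdt.simps) simp
  also have "\<dots> = T"
  proof -
    \<comment> \<open>The filter in \<open>delete_corner\<close> thus removes at most the row in
      which \<open>m\<close> stood alone.\<close>
    have "[] \<notin> set T"
      using T(2) by (force simp: is_partition_def shape_def)
    then have "filter (\<lambda>R. R \<noteq> []) T = T"
      by (auto simp: filter_id_conv)
    then show ?thesis
      using s by (auto simp: delete_corner_def add_entry_def nth_append list_update_append)
  qed
  finally show ?thesis
    by (simp add: jdt_delete_def pos)
qed

section \<open>Edges of the standard representation\<close>

lemma bij_betw_relabel: "bij_betw (relabel k) (vertices k) {1..2 * k}"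
proof -
  have "inj_on (relabel k) (vertices k)"
    by (auto simp: inj_on_def vertices_def)
  moreover have "relabel k ` vertices k = {1..2 * k}"
  proof
    show "relabel k ` vertices k \<subseteq> {1..2 * k}"
      by (auto simp: vertices_def)
    show "{1..2 * k} \<subseteq> relabel k ` vertices k"
    proof
      fix v assume v: "v \<in> {1..2 * k}"
      show "v \<in> relabel k ` vertices k"
      proof (cases "v \<le> k")
        case True
        then show ?thesis
          using v by (intro image_eqI[of _ _ "Unprimed v"]) (auto simp: vertices_def)
      next
        case False
        then show ?thesis
          using v by (intro image_eqI[of _ _ "Primed (2 * k + 1 - v)"]) (auto simp: vertices_def image_iff)
      qed
    qed
  qed
  ultimately show ?thesis
    by (simp add: bij_betw_def)
qed

lemma partition_on_standardize:
  assumes "d \<in> set_partitions k"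
  shows "partition_on {1..2 * k} (standardize k d)"
proof -
  have d: "partition_on (vertices k) d"
    using assms by (simp add: set_partitions_def)
  then have U: "\<Union>d = vertices k" and ne: "{} \<notin> d" and dis: "disjoint d"
    by (auto simp: partition_on_def)
  have "inj_on (relabel k) (\<Union>d)" "relabel k ` \<Union>d = {1..2 * k}"
    using bij_betw_relabel[of k] U by (auto simp: bij_betw_def)
  then show ?thesis
    using ne dis unfolding partition_on_def standardize_def
    by (auto simp: disjoint_image simp flip: image_Union)
qed

lemma edge_less: "edge k d i j \<Longrightarrow> i < j"
  by (simp add: edge_def)

lemma edge_range:
  assumes "d \<in> set_partitions k" "edge k d i j"
  shows "1 \<le> i" "j \<le> 2 * k"
  using partition_on_standardize[OF assms(1)] assms(2)
  by (fastforce simp: edge_def partition_on_def)+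

lemma standardize_block_unique:
  assumes "d \<in> set_partitions k" "B \<in> standardize k d" "C \<in> standardize k d" "v \<in> B" "v \<in> C"
  shows "B = C"
  using partition_on_standardize[OF assms(1)] assms(2-5)
  by (auto simp: partition_on_def disjoint_def)

lemma edge_right_unique:
  assumes "d \<in> set_partitions k" "edge k d i j" "edge k d i j'"
  shows "j = j'"
  using assms(2,3) standardize_block_unique[OF assms(1)] unfolding edge_def
  by (metis linorder_neqE_nat)

lemma edge_left_unique:
  assumes "d \<in> set_partitions k" "edge k d i j" "edge k d i' j"
  shows "i = i'"
  using assms(2,3) standardize_block_unique[OF assms(1)] unfolding edge_def
  by (metis linorder_neqE_nat)

text \<open>Vertex \<open>i\<close> gets number \<open>i\<close> and its mirror image gets
  \<open>2 * k + 1 - i\<close>, so the flip reverses the row of vertices.\<close>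

lemma standardize_flip:
  assumes "d \<in> set_partitions k"
  shows "standardize k (flip d) = (\<lambda>B. (\<lambda>v. 2 * k + 1 - v) ` B) ` standardize k d"
proof -
  have "relabel k (flip_vertex v) = 2 * k + 1 - relabel k v" if "v \<in> vertices k" for v
    using that by (auto simp: vertices_def)
  moreover have "v \<in> vertices k" if "v \<in> B" "B \<in> d" for v B
    using assms that by (auto simp: set_partitions_def partition_on_def)
  ultimately show ?thesis
    unfolding standardize_def flip_def image_image
    by (intro image_cong refl) simp
qed

lemma edge_flip_imp:
  assumes "d \<in> set_partitions k" "edge k d i j"
  shows "edge k (flip d) (2 * k + 1 - j) (2 * k + 1 - i)"
proof -
  obtain B where B: "B \<in> standardize k d" "i < j" "i \<in> B" "j \<in> B" "\<not> (\<exists>m\<in>B. i < m \<and> m < j)"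
    using assms(2) by (auto simp: edge_def)
  have "B \<subseteq> {1..2 * k}"
    using partition_on_standardize[OF assms(1)] B(1) by (auto simp: partition_on_def)
  then have "\<not> (\<exists>m\<in>(\<lambda>v. 2 * k + 1 - v) ` B. 2 * k + 1 - j < m \<and> m < 2 * k + 1 - i)"
    using B(5) by auto
  moreover have "(\<lambda>v. 2 * k + 1 - v) ` B \<in> standardize k (flip d)"
    using B(1) standardize_flip[OF assms(1)] by blast
  moreover have "2 * k + 1 - j < 2 * k + 1 - i"
    using B(2) edge_range[OF assms] by linarith
  ultimately show ?thesis
    using B(3,4) unfolding edge_def by blast
qed

lemma flip_flip: "flip (flip d) = d"
proof -
  have "flip_vertex (flip_vertex v) = v" for v
    by (cases v) auto
  then show ?thesis
    by (simp add: flip_def image_image)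
qed

section \<open>The insertion map through partial permutations\<close>

definition edge_perm :: "nat \<Rightarrow> vertex set set \<Rightarrow> nat \<Rightarrow> nat option" where
  "edge_perm k d i = insertion_sequence k d (2 * i)"

lemma edge_perm_eq_Some:
  assumes "d \<in> set_partitions k"
  shows "edge_perm k d i = Some a \<longleftrightarrow> (\<exists>j. edge k d i j \<and> a = 2 * k + 1 - j)"
proof -
  have "(THE l. edge k d i l) = j" if "edge k d i j" for j
    using that edge_right_unique[OF assms] by blast
  then show ?thesis
    unfolding edge_perm_def insertion_sequence_def edge_label_def by (auto simp: Let_def)
qed

lemma partial_inj_edge_perm:
  assumes "d \<in> set_partitions k"
  shows "partial_inj (edge_perm k d)"
  unfolding partial_inj_def
proof (intro allI impI)
  fix i i' a assume "edge_perm k d i = Some a" "edge_perm k d i' = Some a"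
  then obtain j j' where e: "edge k d i j" "edge k d i' j'" "2 * k + 1 - j = 2 * k + 1 - j'"
    using edge_perm_eq_Some[OF assms] by metis
  moreover from e have "j = j'"
    using edge_range(2)[OF assms e(1)] edge_range(2)[OF assms e(2)] by linarith
  ultimately show "i = i'"
    using edge_left_unique[OF assms] by blast
qed

text \<open>Labels count right endpoints from the far end. Reversal turns an edge from
  \<open>x\<close> with label \<open>y\<close> into one from \<open>y\<close> with label
  \<open>x\<close>.\<close>

lemma edge_perm_flip:
  assumes "d \<in> set_partitions k"
  shows "edge_perm k d x = Some y \<longleftrightarrow> edge_perm k (flip d) y = Some x"
proof -
  have *: "edge_perm k (flip e) y = Some x"
    if e: "e \<in> set_partitions k" and x: "edge_perm k e x = Some y" for e x y
  proof -
    obtain j where j: "edge k e x j" "y = 2 * k + 1 - j"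
      using x edge_perm_eq_Some[OF e] by auto
    have "x = 2 * k + 1 - (2 * k + 1 - x)"
      using edge_range[OF e j(1)] edge_less[OF j(1)] by linarith
    then show ?thesis
      using edge_flip_imp[OF e j(1)] edge_perm_eq_Some[OF flip_in_set_partitions[OF e]] j(2)
      by metis
  qed
  show ?thesis
    using *[OF assms] *[OF flip_in_set_partitions[OF assms]] unfolding flip_flip by blast
qed

text \<open>
  At doubled time \<open>n\<close> the open edges are those with left endpoint at most \<open>\<lfloor>n/2\<rfloor>\<close> and
  right endpoint greater than \<open>\<lceil>n/2\<rceil>\<close>.
\<close>

lemma insertion_tableau_eq_perm_tableau:
  assumes d: "d \<in> set_partitions k" and n: "n \<le> 4 * k"
  shows "insertion_tableau k d n =
    perm_tableau (edge_perm k d) (2 * k + 1 - (n + 1) div 2) (n div 2 + 1)"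
  using n
proof (induction n)
  case 0
  \<comment> \<open>At time 0 only position 0 has been read, and it is not a vertex.\<close>
  have "edge_perm k d 0 = None"
    using edge_perm_eq_Some[OF d, of 0] edge_range(1)[OF d, of 0] by (cases "edge_perm k d 0") auto
  then show ?case by simp
next
  case (Suc n)
  let ?f = "edge_perm k d"
  show ?case
  proof (cases "even (Suc n)")
    case True
    then obtain j where j: "Suc n = 2 * j" by (rule evenE)
    have div: "n div 2 + 1 = j" "(n + 1) div 2 = j" "(Suc n + 1) div 2 = j" "Suc n div 2 = j"
      using j by auto
    have seq: "insertion_sequence k d (Suc n) = ?f j"
      by (simp add: edge_perm_def j)
    \<comment> \<open>The right endpoint lies beyond \<open>j\<close>, so the label passes the bound
      and is really inserted.\<close>
    have "y < 2 * k + 1 - j" if y: "?f j = Some y" for y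
    proof -
      obtain l where "edge k d j l" "y = 2 * k + 1 - l"
        using y edge_perm_eq_Some[OF d] by auto
      then show ?thesis
        using edge_less edge_range(2)[OF d] by fastforce
    qed
    moreover have "insertion_tableau k d n = perm_tableau ?f (2 * k + 1 - j) j"
      using Suc.IH Suc.prems unfolding div by simp
    ultimately show ?thesis
      using True unfolding insertion_tableau.simps(2) seq div
      by (auto split: option.split)
  next
    case False
    then obtain i where i: "n = 2 * i" by auto
    \<comment> \<open>This is the label of an edge ending at vertex \<open>i + 1\<close>. The odd
      step lowers the bound from \<open>Suc m\<close> to \<open>m\<close>, thereby dropping exactly
      this value.\<close>
    define m where "m = 2 * k - i"
    have m: "2 * k + 1 - i = Suc m" "2 * k + 1 - Suc i = m"
      using i Suc.prems by (auto simp: m_def)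
    have div: "n div 2 = i" "(n + 1) div 2 = i" "(Suc n + 1) div 2 = Suc i" "Suc n div 2 = i"
      using i by auto
    let ?T = "perm_tableau ?f m (i + 1)"
    have IH: "insertion_tableau k d n = perm_tableau ?f (Suc m) (i + 1)"
      using Suc.IH Suc.prems unfolding div m by simp
    have seq: "insertion_sequence k d (Suc n) =
        (if \<exists>x. edge k d x (Suc i) then Some m else None)"
      using False div(3) m by (simp add: insertion_sequence_def edge_label_def i)
    have edge: "edge k d x (Suc i) \<longleftrightarrow> x < Suc i \<and> ?f x = Some m" for x
    proof -
      have "j = Suc i" if "edge k d x j" "m = 2 * k + 1 - j" for j
        using edge_range(2)[OF d that(1)] that(2) m Suc.prems i by linarith
      then show ?thesis
        using edge_perm_eq_Some[OF d, of x m] edge_less[of k d x "Suc i"] m by metis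
    qed
    have "insertion_tableau k d (Suc n) = ?T"
    proof (cases "\<exists>x. edge k d x (Suc i)")
      case True
      then obtain x where "x < i + 1" "?f x = Some m"
        using edge by auto
      then obtain s where s: "s \<le> length ?T" "perm_tableau ?f (Suc m) (i + 1) = add_entry s m ?T"
        using perm_tableau_bound_present[OF partial_inj_edge_perm[OF d]] by blast
      have "insertion_tableau k d (Suc n) = jdt_delete m (add_entry s m ?T)"
        using True False unfolding insertion_tableau.simps(2) seq IH s(2) by simp
      then show ?thesis
        using jdt_delete_add_entry[OF entries_perm_tableau
            is_partition_perm_shape[OF partial_inj_edge_perm[OF d]] s(1)] by simp
    next
      case no_edge: False
      then have "\<forall>x<i + 1. ?f x \<noteq> Some m"
        using edge by auto
      then show ?thesis
        using no_edge unfolding insertion_tableau.simps(2) seq IH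
        by (simp only: if_False option.case perm_tableau_bound_absent)
    qed
    then show ?thesis
      unfolding div m by simp
  qed
qed

lemma insertion_shape_flip:
  assumes d: "d \<in> set_partitions k" and n: "n \<le> 4 * k"
  shows "insertion_shape k (flip d) n = insertion_shape k d (4 * k - n)"
proof -
  \<comment> \<open>Reversing time exchanges the position bound with the value bound, which is what
    inverting the partial permutation requires.\<close>
  have "(4 * k - n) div 2 + 1 = 2 * k + 1 - (n + 1) div 2"
    "2 * k + 1 - (4 * k - n + 1) div 2 = n div 2 + 1"
    using n by presburger+
  then show ?thesis
    using insertion_tableau_eq_perm_tableau[OF flip_in_set_partitions[OF d] n]
      insertion_tableau_eq_perm_tableau[OF d, of "4 * k - n"]
      perm_shape_inverse[OF edge_perm_flip[OF d]]
    by (simp add: insertion_shape_def)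
qed

theorem corollary5p6:
  fixes k :: nat and d :: "vertex set set" and P Q :: "nat list list"
  assumes "k \<ge> 1"
    and "d \<in> set_partitions k"
    and "inserts_to k d (P, Q)"
  shows "inserts_to k (flip d) (Q, P)"
proof -
  \<comment> \<open>Entry \<open>i\<close> of \<open>P_sequence\<close> is taken at doubled time
    \<open>4 * k - i\<close>, entry \<open>i\<close> of \<open>Q_sequence\<close> at time
    \<open>i\<close>.\<close>
  have "P_sequence k (flip d) = Q_sequence k d" "Q_sequence k (flip d) = P_sequence k d"
    unfolding P_sequence_def Q_sequence_def
    by (auto intro!: nth_equalityI simp: rev_nth insertion_shape_flip[OF assms(2)] simp del: upt_Suc)
  then show ?thesis
    using assms(3) by (simp add: inserts_to_def)
qed

end
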